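(* After a change of coordinates (possibly rescaling and rotating the coordinate axes and removing a constant velocity shift), the continuum Hamiltonian of a massless quantum walk with a two-dimensional coin is massless and relativistic.
   Context: A quantum walk is a single quantum particle on the lattice $\mathbb{Z}^d$ with Hilbert space $\mathcal{H}_C\otimes\mathcal{H}_P$. Here $\mathcal{H}_P$ has orthonormal basis $|\vec n\rangle$, $\vec n\in\mathbb{Z}^d$, and $\mathcal{H}_C$ is a finite-dimensional extra degree of freedom (the coin). In each discrete timestep it evolves by a unitary that is translationally invariant in space and time and causal. Such a unitary has the form $U=\sum_{\vec q\in Q}A_{\vec q}S_{\vec q}$, where $Q\subset\mathbb{Z}^d$ is finite, the $A_{\vec q}$ are operators on $\mathcal{H}_C$, and $S_{\vec q}|\vec n\rangle=|\vec n+\vec q\rangle$. The coin is two-dimensional when $\dim\mathcal{H}_C=2$. The walk is massless when $\sum_{\vec q\in Q}A_{\vec q}=\mathbb{I}$. Let $a$ be the lattice spacing, which is also the length of a timestep, and let $\vec P=(P_1,\dots,P_d)$, $P_b=-i\partial_{x_b}$, be the continuum momentum operator, so that $S_{\vec q}$ acts as $e^{-i\vec q\cdot\vec P a}$. In the continuum limit $a\to0$ with $t=Na$ fixed, the evolution $U^N$ of a massless walk converges to $e^{-iHt}$ (on states with a momentum cutoff that grows sufficiently slowly as $a\to0$), with continuum Hamiltonian $H=\sum_{\vec q\in Q}A_{\vec q}\,\vec q\cdot\vec P$. Removing a constant velocity shift means removing a term of the form $\mathbb{I}\,\vec v\cdot\vec P$ with $\vec v\in\mathbb{R}^d$, by passing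 to coordinates moving with constant velocity. For a two-component particle, the massless relativistic Hamiltonians are the Weyl Hamiltonians $\pm\vec\sigma\cdot\vec P$ in three space dimensions, and the massless Dirac Hamiltonians $P_x\sigma_x+P_y\sigma_y$ in two and $P\sigma_z$ in one space dimension (up to a unitary change of basis of the coin), with $\sigma_x,\sigma_y,\sigma_z$ the Pauli matrices. The particle may evolve by the equation of a dimension lower than $d$ (in particular, at most three when $d>3$), in which case it does not move along the remaining directions. *)

theory Defs
  imports "HOL-Analysis.Analysis"
begin

section \<open>Complex matrices acting on the coin space\<close>

definition conj_transpose :: "complex^'c^'c \<Rightarrow> complex^'c^'c" where
  "conj_transpose M = map_matrix cnj (transpose M)"

definition unitary_matrix :: "complex^'c^'c \<Rightarrow> bool" where
  "unitary_matrix W \<longleftrightarrow> conj_transpose W ** W = mat 1 \<and> W ** conj_transpose W = mat 1"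

definition pauli_x :: "complex^2^2" where
  "pauli_x = vector [vector [0, 1], vector [1, 0]]"

definition pauli_y :: "complex^2^2" where
  "pauli_y = vector [vector [0, -\<i>], vector [\<i>, 0]]"

definition pauli_z :: "complex^2^2" where
  "pauli_z = vector [vector [1, 0], vector [0, -1]]"


section \<open>Quantum walks on the lattice\<close>

text \<open>
  The Hilbert space \<open>\<H>\<^sub>C \<otimes> \<H>\<^sub>P\<close> is realised as the space of square-summable
  functions from the lattice \<open>int^'d\<close> to the coin space \<open>complex^'c\<close>: the function \<open>\<psi>\<close>
  stands for the sum of \<open>\<psi> n \<otimes> |n\<rangle>\<close> over all lattice sites \<open>n\<close>.
\<close>

definition lattice_states :: "(int^'d \<Rightarrow> complex^'c) set" where
  "lattice_states = {\<psi>. (\<lambda>n. (norm (\<psi> n))\<^sup>2) summable_on UNIV}"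

definition lattice_inner ::
  "(int^'d \<Rightarrow> complex^'c) \<Rightarrow> (int^'d \<Rightarrow> complex^'c) \<Rightarrow> complex" where
  "lattice_inner \<phi> \<psi> = (\<Sum>\<^sub>\<infinity>n. \<Sum>k\<in>UNIV. cnj (\<phi> n $ k) * \<psi> n $ k)"

definition shift :: "int^'d \<Rightarrow> (int^'d \<Rightarrow> complex^'c) \<Rightarrow> int^'d \<Rightarrow> complex^'c" where
  "shift q \<psi> n = \<psi> (n - q)"

definition walk_operator ::
  "(int^'d) set \<Rightarrow> (int^'d \<Rightarrow> complex^'c^'c) \<Rightarrow>
    (int^'d \<Rightarrow> complex^'c) \<Rightarrow> int^'d \<Rightarrow> complex^'c" where
  "walk_operator Q A \<psi> n = (\<Sum>q\<in>Q. A q *v shift q \<psi> n)"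

text \<open>
  Linearity of the walk operator is automatic, so unitarity is surjectivity together with
  preservation of the inner product.
\<close>

definition quantum_walk :: "(int^'d) set \<Rightarrow> (int^'d \<Rightarrow> complex^'c^'c) \<Rightarrow> bool" where
  "quantum_walk Q A \<longleftrightarrow> finite Q \<and>
     walk_operator Q A ` lattice_states = lattice_states \<and>
     (\<forall>\<phi>\<in>lattice_states. \<forall>\<psi>\<in>lattice_states.
        lattice_inner (walk_operator Q A \<phi>) (walk_operator Q A \<psi>) = lattice_inner \<phi> \<psi>)"

definition massless :: "(int^'d) set \<Rightarrow> (int^'d \<Rightarrow> complex^'c^'c) \<Rightarrow> bool" where
  "massless Q A \<longleftrightarrow> (\<Sum>q\<in>Q. A q) = mat 1"


section \<open>Hamiltonians in the continuum\<close>

text \<open>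
  Continuum Hamiltonians are first-order differential operators. They are represented as maps
  on all functions, but only their values on differentiable wave functions are meaningful.
\<close>

type_synonym ('d, 'c) wave = "real^'d \<Rightarrow> complex^'c"

definition momentum :: "'d::finite \<Rightarrow> ('d, 'c::finite) wave \<Rightarrow> ('d, 'c) wave" where
  "momentum b \<phi> x = (-\<i>) *s frechet_derivative \<phi> (at x) (axis b 1)"

definition dot_momentum :: "real^'d \<Rightarrow> ('d::finite, 'c::finite) wave \<Rightarrow> ('d, 'c) wave" where
  "dot_momentum k \<phi> x = (\<Sum>b\<in>UNIV. complex_of_real (k $ b) *s momentum b \<phi> x)"

definition continuum_hamiltonian ::
  "(int^'d) set \<Rightarrow> (int^'d \<Rightarrow> complex^'c^'c) \<Rightarrow>
    ('d::finite, 'c::finite) wave \<Rightarrow> ('d, 'c) wave" where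
  "continuum_hamiltonian Q A \<phi> x =
     (\<Sum>q\<in>Q. A q *v dot_momentum (\<chi> b. real_of_int (q $ b)) \<phi> x)"


section \<open>Changes of coordinates\<close>

text \<open>
  In coordinates moving with velocity \<open>v\<close> the wave function \<open>\<phi>\<close> is given by
  \<open>\<psi>(t, x) = \<phi>(t, x - t v)\<close>. As \<open>i \<partial>\<^sub>t \<psi>\<close> corresponds to \<open>i \<partial>\<^sub>t \<phi> + v \<cdot> P \<phi>\<close>, the equation
  \<open>i \<partial>\<^sub>t \<psi> = H \<psi>\<close> turns into \<open>i \<partial>\<^sub>t \<phi> = (H - v \<cdot> P) \<phi>\<close> (\<open>H\<close> being translation invariant).
\<close>

definition remove_velocity ::
  "real^'d \<Rightarrow> (('d::finite, 'c::finite) wave \<Rightarrow> ('d, 'c) wave) \<Rightarrow>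
    ('d, 'c) wave \<Rightarrow> ('d, 'c) wave" where
  "remove_velocity v H \<phi> x = H \<phi> x - dot_momentum v \<phi> x"

text \<open>
  The new coordinates are \<open>y = rotate_rescale R s x\<close>: first the axes are rotated by \<open>R\<close>, then
  the \<open>b\<close>-th rotated axis is rescaled by the factor \<open>s $ b\<close>.
\<close>

definition rotate_rescale :: "real^'d^'d \<Rightarrow> real^'d \<Rightarrow> real^'d \<Rightarrow> real^'d" where
  "rotate_rescale R s x = (\<chi> b. s $ b * (R *v x) $ b)"

text \<open>The operator \<open>H\<close> expressed in the coordinates \<open>y = L x\<close>, for bijective \<open>L\<close>.\<close>

definition in_coordinates ::
  "(real^'d \<Rightarrow> real^'d) \<Rightarrow> (('d::finite, 'c::finite) wave \<Rightarrow> ('d, 'c) wave) \<Rightarrow>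
    ('d, 'c) wave \<Rightarrow> ('d, 'c) wave" where
  "in_coordinates L H \<phi> y = H (\<lambda>x. \<phi> (L x)) (inv L y)"


section \<open>Massless relativistic Hamiltonians\<close>

definition weyl_hamiltonian ::
  "'d::finite \<Rightarrow> 'd \<Rightarrow> 'd \<Rightarrow> ('d, 2) wave \<Rightarrow> ('d, 2) wave" where
  "weyl_hamiltonian i j k \<phi> x =
     pauli_x *v momentum i \<phi> x + pauli_y *v momentum j \<phi> x + pauli_z *v momentum k \<phi> x"

definition dirac2_hamiltonian :: "'d::finite \<Rightarrow> 'd \<Rightarrow> ('d, 2) wave \<Rightarrow> ('d, 2) wave" where
  "dirac2_hamiltonian i j \<phi> x = pauli_x *v momentum i \<phi> x + pauli_y *v momentum j \<phi> x"

definition dirac1_hamiltonian :: "'d::finite \<Rightarrow> ('d, 2) wave \<Rightarrow> ('d, 2) wave" where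
  "dirac1_hamiltonian i \<phi> x = pauli_z *v momentum i \<phi> x"

text \<open>
  The equation may be of lower dimension than \<open>'d\<close>: it then involves only the distinct
  axes \<open>i, j, k\<close>. In dimension zero the particle moves along no direction and
  the Hamiltonian vanishes; this cannot be excluded, as it occurs for instance for the walk
  that is a pure shift.
\<close>

inductive massless_relativistic_form ::
  "(('d::finite, 2) wave \<Rightarrow> ('d, 2) wave) \<Rightarrow> bool" where
  dim3_pos: "distinct [i, j, k] \<Longrightarrow> massless_relativistic_form (weyl_hamiltonian i j k)"
| dim3_neg: "distinct [i, j, k] \<Longrightarrow>
    massless_relativistic_form (\<lambda>\<phi> x. - weyl_hamiltonian i j k \<phi> x)"
| dim2: "distinct [i, j] \<Longrightarrow> massless_relativistic_form (dirac2_hamiltonian i j)"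
| dim1: "massless_relativistic_form (dirac1_hamiltonian i)"
| dim0: "massless_relativistic_form (\<lambda>\<phi> x. 0)"

definition change_coin_basis ::
  "complex^'c^'c \<Rightarrow> (('d::finite, 'c::finite) wave \<Rightarrow> ('d, 'c) wave) \<Rightarrow>
    ('d, 'c) wave \<Rightarrow> ('d, 'c) wave" where
  "change_coin_basis W K \<phi> x = W *v K (\<lambda>y. conj_transpose W *v \<phi> y) x"

definition massless_relativistic ::
  "(('d::finite, 2) wave \<Rightarrow> ('d, 2) wave) \<Rightarrow> bool" where
  "massless_relativistic H \<longleftrightarrow>
     (\<exists>K W. massless_relativistic_form K \<and> unitary_matrix W \<and>
        (\<forall>\<phi>. \<phi> differentiable_on UNIV \<longrightarrow> H \<phi> = change_coin_basis W K \<phi>))"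

end

theory Submission
  imports Defs
begin

text \<open>
  Unitarity of the walk on the lattice basis states says that the products \<open>A\<^sub>q\<^sup>\<dagger> A\<^sub>q\<^sub>'\<close>
  with fixed difference \<open>q - q' = m\<close> sum to the identity for \<open>m = 0\<close> and to zero otherwise.
  Weighting these relations with a component of \<open>m\<close> and using \<open>\<Sum>\<^sub>q A\<^sub>q = 1\<close> shows that each
  \<open>B\<^sub>b = \<Sum>\<^sub>q q\<^sub>b A\<^sub>q\<close> is Hermitian, so \<open>B\<^sub>b = v\<^sub>b + n\<^sub>b \<cdot> \<sigma>\<close> with \<open>v\<^sub>b\<close> real and \<open>n\<^sub>b\<close> a real
  three-vector. Once the velocity \<open>v\<close> is removed, the singular value decomposition of the real
  matrix with columns \<open>n\<^sub>b\<close> gives a rotation after which these columns are pairwise orthogonal, hence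
  at most three of them are nonzero; rescaling the axes makes the nonzero ones unit vectors. Orthonormal
  vectors of Pauli coefficients are then brought to the standard Pauli matrices by a unitary.
\<close>

section \<open>Matrices\<close>

lemma matrix_vector_mult_axis:
  fixes M :: "complex^'n^'m"
  shows "M *v axis k 1 = column k M"
  by (simp add: vec_eq_iff matrix_vector_mult_def column_def axis_def if_distrib cong: if_cong)

lemma conj_transpose_component: "conj_transpose M $ i $ j = cnj (M $ j $ i)"
  by (simp add: conj_transpose_def map_matrix_def transpose_def)

lemma of_real_vector_smult: "complex_of_real a *s v = a *\<^sub>R v"
  by (simp add: vec_eq_iff) (simp add: scaleR_conv_of_real)

lemma matrix_vector_mult_scaleR_complex:
  fixes M :: "complex^'n^'m"
  shows "M *v (a *\<^sub>R x) = a *\<^sub>R (M *v x)"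
  by (simp add: vec_eq_iff matrix_vector_mult_def scaleR_sum_right)

lemma scaleR_matrix_vector_mult:
  fixes M :: "complex^'n^'m"
  shows "(a *\<^sub>R M) *v x = a *\<^sub>R (M *v x)"
  by (simp add: vec_eq_iff matrix_vector_mult_def scaleR_sum_right)

lemma sum_matrix_vector_mult:
  fixes M :: "'i \<Rightarrow> complex^'n^'m"
  shows "(\<Sum>i\<in>I. M i) *v x = (\<Sum>i\<in>I. M i *v x)"
  by (induction I rule: infinite_finite_induct) (auto simp: matrix_vector_mult_add_rdistrib)

lemma matrix_vector_mult_sum:
  fixes M :: "complex^'n^'m"
  shows "M *v (\<Sum>i\<in>I. x i) = (\<Sum>i\<in>I. M *v x i)"
  by (induction I rule: infinite_finite_induct) (auto simp: matrix_vector_right_distrib)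

text \<open>Turns an intertwining relation into the shape of \<open>change_coin_basis\<close>:
  \<open>W\<close> acts outside, its adjoint on the wave function.\<close>

lemma unitary_conjugate_mult:
  fixes M P W :: "complex^'n^'n"
  assumes "unitary_matrix W" and "M ** W = W ** P"
  shows "M *v x = W *v (P *v (conj_transpose W *v x))"
proof -
  have "M = M ** (W ** conj_transpose W)"
    using assms(1) by (simp add: unitary_matrix_def)
  also have "\<dots> = W ** P ** conj_transpose W"
    by (simp add: matrix_mul_assoc assms(2))
  finally show ?thesis by (simp add: matrix_vector_mul_assoc matrix_mul_assoc)
qed

section \<open>Hermitian two-by-two matrices\<close>

text \<open>This is u_1 sigma_x + u_2 sigma_y + u_3 sigma_z: real three-vectors parametrise the
  traceless Hermitian matrices.\<close>

definition pauli_comb :: "real^3 \<Rightarrow> complex^2^2" where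
  "pauli_comb u = vector [vector [complex_of_real (u$3), Complex (u$1) (- u$2)],
                          vector [Complex (u$1) (u$2), complex_of_real (- u$3)]]"

lemma pauli_comb_component:
  "pauli_comb u $ 1 $ 1 = complex_of_real (u$3)" "pauli_comb u $ 1 $ 2 = Complex (u$1) (- u$2)"
  "pauli_comb u $ 2 $ 1 = Complex (u$1) (u$2)" "pauli_comb u $ 2 $ 2 = complex_of_real (- u$3)"
  by (simp_all add: pauli_comb_def)

lemma linear_pauli_comb: "linear pauli_comb"
  by (rule linearI)
    (simp_all add: vec_eq_iff forall_2 pauli_comb_component complex_eq_iff)

text \<open>The Pauli algebra: matrices of orthogonal vectors anticommute, and their product is i
  times the matrix of the cross product.\<close>

lemma pauli_comb_mult:
  "pauli_comb a ** pauli_comb b = (a \<bullet> b) *\<^sub>R mat 1 + (\<chi> i j. \<i> * pauli_comb (cross3 a b) $ i $ j)"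
  by (simp add: vec_eq_iff forall_2 matrix_matrix_mult_def sum_2 sum_3 pauli_comb_component
      cross3_simps inner_vec_def mat_def complex_eq_iff cross3_def algebra_simps)

text \<open>Half the trace gives the multiple of the identity; the traceless remainder is determined
  by its lower left entry and half the difference of the diagonal entries.\<close>

lemma hermitian_eq_pauli_comb:
  fixes B :: "complex^2^2"
  assumes "conj_transpose B = B"
  shows "B = ((Re (B$1$1) + Re (B$2$2)) / 2) *\<^sub>R mat 1
    + pauli_comb (vector [Re (B$2$1), Im (B$2$1), (Re (B$1$1) - Re (B$2$2)) / 2])"
proof -
  have "cnj (B $ j $ i) = B $ i $ j" for i j
    using arg_cong[OF assms, of "\<lambda>M. M $ i $ j"]
    by (simp add: conj_transpose_def map_matrix_def transpose_def)
  from this[of 1 1] this[of 1 2] this[of 2 1] this[of 2 2] show ?thesis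
    by (simp add: vec_eq_iff forall_2 pauli_comb_component mat_def complex_eq_iff field_simps)
qed

text \<open>The three matrices obey the relations of the standard Pauli matrices. The columns of
  \<open>W\<close> are a unit eigenvector \<open>e\<close> of the third matrix for eigenvalue 1 and
  its image \<open>f\<close> under the first, which flips the spin.\<close>

lemma pauli_frame:
  fixes u w :: "real^3"
  assumes u: "norm u = 1" and w: "norm w = 1" and uw: "orthogonal u w"
  obtains W where "unitary_matrix W"
    and "pauli_comb u ** W = W ** pauli_x"
    and "pauli_comb w ** W = W ** pauli_y"
    and "pauli_comb (cross3 u w) ** W = W ** pauli_z"
proof -
  define z where "z = cross3 u w"
  \<comment> \<open>The standard inner product, for which every \<open>pauli_comb\<close> is
    self-adjoint.\<close>
  define h :: "complex^2 \<Rightarrow> complex^2 \<Rightarrow> complex" 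
    where "h x y = cnj (x$1) * y$1 + cnj (x$2) * y$2" for x y
  have herm: "h (pauli_comb a *v x) y = h x (pauli_comb a *v y)" for a x y
    by (simp add: h_def matrix_vector_mult_def sum_2 pauli_comb_component complex_eq_iff
        algebra_simps)
  have nz: "norm z = 1"
    using norm_cross_dot[of u w] u w uw by (simp add: z_def orthogonal_def power2_eq_1_iff)
      (smt (verit) norm_ge_zero)
  have uu: "u \<bullet> u = 1" and ww: "w \<bullet> w = 1" and uw0: "u \<bullet> w = 0" and zz: "z \<bullet> z = 1"
    using u w uw nz by (simp_all add: norm_eq_1 orthogonal_def)
  have uz: "u \<bullet> z = 0" "z \<bullet> u = 0" by (simp_all add: z_def dot_cross_self)
  have czu': "cross3 u z = - w" by (simp add: z_def Lagrange uu uw0)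
  then have czu: "cross3 z u = w" using cross_skew[of z u] by simp
  have N1N1: "pauli_comb u *v (pauli_comb u *v x) = x" for x
    by (simp add: matrix_vector_mul_assoc pauli_comb_mult uu)
      (simp add: vec_eq_iff forall_2 matrix_vector_mult_def sum_2 mat_def pauli_comb_component Complex_eq_0)
  have N3N1: "pauli_comb z *v (pauli_comb u *v x) = \<i> *s (pauli_comb w *v x)" for x
    by (simp add: matrix_vector_mul_assoc pauli_comb_mult uz czu)
      (simp add: vec_eq_iff forall_2 matrix_vector_mult_def sum_2 mat_def pauli_comb_component
        algebra_simps)
  have N1N3: "pauli_comb u *v (pauli_comb z *v x) = - (\<i> *s (pauli_comb w *v x))" for x
    by (simp add: matrix_vector_mul_assoc pauli_comb_mult uz czu' linear_neg[OF linear_pauli_comb])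
      (simp add: vec_eq_iff forall_2 matrix_vector_mult_def sum_2 mat_def pauli_comb_component
        algebra_simps)
  \<comment> \<open>The matrix of \<open>z\<close> squares to 1, so a nonzero column of 1 plus this
    matrix is an eigenvector for eigenvalue 1. The first column is the witness; it vanishes exactly
    when \<open>z\<close> is (0, 0, -1), where the second basis vector serves.\<close>
  obtain e0 where e0: "e0 \<noteq> 0" "pauli_comb z *v e0 = e0"
  proof (cases "z$3 = -1")
    case True
    have "(z$1)\<^sup>2 + (z$2)\<^sup>2 = 0"
      using zz True by (simp add: inner_vec_def sum_3 power2_eq_square)
    then have "z$1 = 0" "z$2 = 0" by (simp_all add: sum_power2_eq_zero_iff)
    then show ?thesis using True
      by (intro that[of "vector [0,1]"]) (auto simp: vec_eq_iff forall_2 matrix_vector_mult_def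
          sum_2 pauli_comb_component complex_eq_iff)
  next
    case False
    have "z$1 * z$1 + z$2 * z$2 + z$3 * z$3 = 1"
      using zz by (simp add: inner_vec_def sum_3)
    with False show ?thesis
      by (intro that[of "vector [complex_of_real (1 + z$3), Complex (z$1) (z$2)]"])
        (auto simp: vec_eq_iff forall_2 matrix_vector_mult_def
          sum_2 pauli_comb_component complex_eq_iff algebra_simps)
  qed
  define e where "e = inverse (norm e0) *\<^sub>R e0"
  have e: "pauli_comb z *v e = e"
    using e0 by (simp add: e_def matrix_vector_mult_scaleR_complex)
  have "norm e = 1" using e0 by (simp add: e_def)
  then have hee: "h e e = 1"
    by (simp add: h_def norm_vec_def L2_set_def sum_2 complex_eq_iff cmod_power2)
      (simp add: power2_eq_square)
  \<comment> \<open>As the matrices of \<open>u\<close> and \<open>z\<close> anticommute,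
    \<open>f\<close> belongs to the eigenvalue -1 of the latter.\<close>
  define f where "f = pauli_comb u *v e"
  have f1: "pauli_comb u *v f = e" by (simp add: f_def N1N1)
  have w_eq: "pauli_comb w *v e = \<i> *s f"
    using N1N3[of e] e by (simp add: f_def vec_eq_iff complex_eq_iff)
  have f3: "pauli_comb z *v f = - f"
    using N3N1[of e] w_eq by (simp add: f_def vec_eq_iff)
  have f2: "pauli_comb w *v f = - (\<i> *s e)"
  proof -
    have "pauli_comb u *v - f = - e"
      using matrix_vector_mult_scaleR_complex[of "pauli_comb u" "-1" f] f1 by simp
    with N1N3[of f] f3 show ?thesis by (simp add: vec_eq_iff complex_eq_iff)
  qed
  have hff: "h f f = 1" using herm[of u e f] f1 hee by (simp add: f_def)
  \<comment> \<open>Eigenvectors of a self-adjoint matrix for the distinct eigenvalues 1 and -1 are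
    orthogonal.\<close>
  have "h e (- f) = - h e f" by (simp add: h_def)
  then have "h e f = - h e f" using herm[of z e f] e f3 by simp
  then have hef: "h e f = 0" by (simp add: complex_eq_iff)
  have hfe: "h f e = 0" using herm[of u e e] hef by (simp add: f_def)
  define W :: "complex^2^2" where "W = vector [vector [e$1, f$1], vector [e$2, f$2]]"
  have "conj_transpose W ** W = mat 1"
    using hee hff hef hfe
    by (simp add: vec_eq_iff forall_2 matrix_matrix_mult_def sum_2 conj_transpose_def
        map_matrix_def transpose_def W_def h_def mat_def)
  then have "unitary_matrix W"
    unfolding unitary_matrix_def using matrix_left_right_inverse by blast
  moreover have "pauli_comb u ** W = W ** pauli_x"
    using f1 f_def[symmetric] by (simp add: vec_eq_iff forall_2 matrix_matrix_mult_def sum_2 matrix_vector_mult_def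
       W_def pauli_x_def)
  moreover have "pauli_comb w ** W = W ** pauli_y"
    using f2 w_eq by (simp add: vec_eq_iff forall_2 matrix_matrix_mult_def sum_2 matrix_vector_mult_def
       W_def pauli_y_def algebra_simps)
  moreover have "pauli_comb z ** W = W ** pauli_z"
    using f3 e by (simp add: vec_eq_iff forall_2 matrix_matrix_mult_def sum_2 matrix_vector_mult_def
       W_def pauli_z_def algebra_simps)
  ultimately show ?thesis using that unfolding z_def by blast
qed

text \<open>A vector orthogonal to \<open>a\<close> and \<open>b\<close> has zero cross product with
  \<open>cross3 a b\<close>, so it is parallel to it; unit length leaves only the sign.\<close>

lemma orthonormal_cross3:
  fixes a b c :: "real^3"
  assumes "norm a = 1" "norm b = 1" "norm c = 1"
    and "orthogonal a b" "orthogonal a c" "orthogonal b c"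
  shows "c = cross3 a b \<or> c = cross3 b a"
proof -
  let ?z = "cross3 a b"
  have nz: "norm ?z = 1"
    using norm_cross_dot[of a b] assms by (simp add: orthogonal_def power2_eq_1_iff)
      (smt (verit) norm_ge_zero)
  have "cross3 c ?z = 0"
    using assms by (simp add: Lagrange orthogonal_def inner_commute)
  then have "(c \<bullet> ?z)\<^sup>2 = 1"
    using norm_cross_dot[of c ?z] nz assms by simp
  then have "c \<bullet> ?z = 1 \<or> c \<bullet> - ?z = 1" by (auto simp: power2_eq_1_iff)
  \<comment> \<open>The equality case of Cauchy-Schwarz for unit vectors.\<close>
  moreover have "c = y" if "c \<bullet> y = 1" "norm y = 1" for y
  proof -
    have "(c - y) \<bullet> (c - y) = 0"
      using that assms(3) by (simp add: inner_diff_left inner_diff_right norm_eq_1 inner_commute)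
    then show ?thesis by simp
  qed
  ultimately show ?thesis using nz cross_skew[of b a] by auto
qed

section \<open>Orthogonalisation by a rotation\<close>

text \<open>Near zero the linear term dominates. The choice t = c / (K + 1) makes this explicit and
  stays defined for K = 0.\<close>

lemma linear_le_quadratic_imp_zero:
  fixes c K :: real
  assumes le: "\<And>t. 2 * t * c \<le> t\<^sup>2 * K" and "0 \<le> K"
  shows "c = 0"
proof -
  have pos: "0 < (K + 1)\<^sup>2" and K1: "K + 1 \<noteq> 0" using \<open>0 \<le> K\<close> by auto
  have "2 * (c / (K + 1)) * c * (K + 1)\<^sup>2 \<le> (c / (K + 1))\<^sup>2 * K * (K + 1)\<^sup>2"
    using le[of "c / (K + 1)"] pos by (simp only: mult_le_cancel_right_pos)
  also have "(c / (K + 1))\<^sup>2 * K * (K + 1)\<^sup>2 = c\<^sup>2 * K"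
    using K1 by (simp add: power_divide)
  also have "2 * (c / (K + 1)) * c * (K + 1)\<^sup>2 = 2 * c\<^sup>2 * (K + 1)"
    using K1 by (simp add: power2_eq_square)
  finally have "c\<^sup>2 * (K + 2) \<le> 0" by (simp add: algebra_simps)
  then show ?thesis using \<open>0 \<le> K\<close> by (simp add: mult_le_0_iff)
qed

text \<open>These are the right singular vectors of \<open>T\<close>, found by induction on the
  dimension: take a unit vector \<open>r\<close> of \<open>S\<close> maximising the norm of
  \<open>T r\<close>, then continue in its orthogonal complement.\<close>

lemma orthogonal_image_basis:
  fixes T :: "'a::euclidean_space \<Rightarrow> 'b::euclidean_space"
  assumes T: "linear T" and S: "subspace S"
  obtains B where "B \<subseteq> S" "span B = S" "card B = dim S" "finite B"
    "pairwise orthogonal B" "\<And>x. x \<in> B \<Longrightarrow> norm x = 1"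
    "pairwise (\<lambda>x y. orthogonal (T x) (T y)) B"
proof -
  have "\<exists>B. B \<subseteq> S \<and> span B = S \<and> card B = dim S \<and> finite B \<and> pairwise orthogonal B \<and>
    (\<forall>x\<in>B. norm x = 1) \<and> pairwise (\<lambda>x y. orthogonal (T x) (T y)) B"
    using S
  proof (induction "dim S" arbitrary: S rule: less_induct)
    case less
    show ?case
    proof (cases "dim S = 0")
      case True
      then have "S = {0}" using less.prems by (metis dim_eq_0 subset_singleton_iff subspace_0 empty_iff)
      then show ?thesis by (intro exI[of _ "{}"]) auto
    next
      case False
      let ?C = "S \<inter> sphere 0 1"
      have "compact ?C" using closed_subspace[OF less.prems] by (simp add: closed_Int_compact)
      moreover from False obtain x0 where x0: "x0 \<in> S" "x0 \<noteq> 0" by (auto simp: dim_eq_0)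
      then have "inverse (norm x0) *\<^sub>R x0 \<in> ?C"
        using less.prems by (simp add: subspace_scale)
      then have "?C \<noteq> {}" by blast
      moreover have "continuous_on ?C (\<lambda>x. norm (T x))"
        by (intro continuous_on_norm linear_continuous_on linear_linear[THEN iffD2] T)
      ultimately obtain r where r: "r \<in> S" "norm r = 1" 
        and max: "\<And>x. x \<in> ?C \<Longrightarrow> norm (T x) \<le> norm (T r)"
        using continuous_attains_sup[of ?C "\<lambda>x. norm (T x)"]
        by (metis (mono_tags, lifting) IntD1 IntD2 mem_sphere_0)
      have max': "norm (T x) \<le> norm (T r) * norm x" if "x \<in> S" for x
      proof (cases "x = 0")
        case True then show ?thesis by (simp add: linear_0[OF T])
      next
        case False
        then have "norm (T (inverse (norm x) *\<^sub>R x)) \<le> norm (T r)"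
          using that less.prems by (intro max) (simp add: subspace_scale)
        then show ?thesis using False by (simp add: linear_scale[OF T] field_simps)
      qed
      \<comment> \<open>The first variation of \<open>|T|\<^sup>2\<close> at the maximiser \<open>r\<close> vanishes in directions orthogonal to \<open>r\<close>.\<close>
      have orth: "orthogonal (T r) (T y)" if y: "y \<in> S" "orthogonal r y" for y
      proof -
        let ?b = "T r \<bullet> T y" and ?K = "(norm (T r))\<^sup>2 * (norm y)\<^sup>2"
        have *: "2 * t * ?b \<le> t\<^sup>2 * ?K" for t
        proof -
          have "(norm (T (r + t *\<^sub>R y)))\<^sup>2 \<le> (norm (T r) * norm (r + t *\<^sub>R y))\<^sup>2"
            using r y less.prems by (intro power_mono max') (auto simp: subspace_add subspace_scale)
          moreover have "(norm (r + t *\<^sub>R y))\<^sup>2 = 1 + t\<^sup>2 * (norm y)\<^sup>2"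
            using y r unfolding power2_norm_eq_inner
            by (simp add: inner_add_left inner_add_right orthogonal_def inner_commute norm_eq_1
                power2_eq_square)
          moreover have "(norm (T (r + t *\<^sub>R y)))\<^sup>2 = (norm (T r))\<^sup>2 + 2 * t * ?b + t\<^sup>2 * (norm (T y))\<^sup>2"
            unfolding power2_norm_eq_inner
            by (simp add: linear_add[OF T] linear_scale[OF T] inner_add_left inner_add_right inner_commute
                power2_eq_square)
          ultimately have "2 * t * ?b + t\<^sup>2 * (norm (T y))\<^sup>2 \<le> t\<^sup>2 * ?K"
            by (simp add: power_mult_distrib algebra_simps)
          moreover have "0 \<le> t\<^sup>2 * (norm (T y))\<^sup>2" by simp
          ultimately show ?thesis by linarith
        qed
        have "?b = 0" using * by (rule linear_le_quadratic_imp_zero) simp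
        then show ?thesis by (simp add: orthogonal_def)
      qed
      \<comment> \<open>The complement of \<open>r\<close> within \<open>S\<close> has one dimension
        less, and its image is orthogonal to \<open>T r\<close> by \<open>orth\<close>, so a basis
        of it can be extended by \<open>r\<close>.\<close>
      define S' where "S' = {y \<in> S. orthogonal r y}"
      have S': "subspace S'"
        using less.prems by (auto simp: S'_def subspace_def orthogonal_clauses)
      have r0: "r \<noteq> 0" using r by auto
      have split: "x - (r \<bullet> x) *\<^sub>R r \<in> S'" if "x \<in> S" for x
        using that r less.prems
        by (auto simp: S'_def orthogonal_def inner_diff_right norm_eq_1 subspace_diff subspace_scale)
      have S_eq: "S = span (insert r S')"
      proof
        show "S \<subseteq> span (insert r S')"
        proof
          fix x assume "x \<in> S"
          then have "x - (r \<bullet> x) *\<^sub>R r \<in> span S'" by (meson split span_base)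
          then show "x \<in> span (insert r S')" by (auto simp: span_insert)
        qed
        show "span (insert r S') \<subseteq> S"
          using r less.prems by (intro span_minimal) (auto simp: S'_def)
      qed
      have rS': "r \<notin> span S'"
        using S' r0 by (simp add: span_eq_iff[THEN iffD2] S'_def orthogonal_self)
      have dS: "dim S = Suc (dim S')"
        using rS' by (subst S_eq) (simp add: dim_insert)
      then obtain B where B: "B \<subseteq> S'" "span B = S'" "card B = dim S'" "finite B"
        "pairwise orthogonal B" "\<forall>x\<in>B. norm x = 1" "pairwise (\<lambda>x y. orthogonal (T x) (T y)) B"
        using less.hyps[of S'] S' by auto
      have "r \<notin> B" using rS' B by (metis span_base)
      moreover have "span (insert r B) = S"
        unfolding S_eq using B(2) S' by (simp add: span_insert span_eq_iff[THEN iffD2])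
      ultimately show ?thesis
        using B r dS orth
        by (intro exI[of _ "insert r B"])
          (auto simp: S'_def pairwise_insert orthogonal_commute)
    qed
  qed
  then show ?thesis using that by blast
qed

text \<open>The singular vectors become the rows of an orthogonal matrix. If its determinant is -1,
  negating one row repairs this and leaves all orthogonality relations intact.\<close>

lemma rotation_orthogonal_images:
  fixes T :: "real^'d \<Rightarrow> 'b::euclidean_space"
  assumes T: "linear T"
  obtains R :: "real^'d^'d" where "rotation_matrix R"
    "\<And>i j. i \<noteq> j \<Longrightarrow> orthogonal (T (row i R)) (T (row j R))"
proof -
  obtain B where B: "card B = CARD('d)" "finite B" "pairwise orthogonal B" 
    "\<And>x. x \<in> B \<Longrightarrow> norm x = 1" "pairwise (\<lambda>x y. orthogonal (T x) (T y)) B"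
    using orthogonal_image_basis[OF T subspace_UNIV]
    by (metis dim_UNIV DIM_cart DIM_real mult.right_neutral)
  then obtain g where g: "bij_betw g (UNIV :: 'd set) B"
    using finite_same_card_bij[of "UNIV :: 'd set" B] by auto
  have gB: "g i \<in> B" for i using g by (auto simp: bij_betw_def)
  have g_neq: "g i \<noteq> g j" if "i \<noteq> j" for i j using g that by (auto simp: bij_betw_def inj_def)
  define R where "R = (\<chi> i. g i)"
  have row_R: "row i R = g i" for i by (simp add: row_def R_def vec_eq_iff)
  have R: "orthogonal_matrix R"
    unfolding orthogonal_matrix_orthonormal_rows row_R
    using B gB g_neq by (auto simp: pairwise_def)
  have orth: "orthogonal (T (row i R)) (T (row j R))" if "i \<noteq> j" for i j
    using B(5) gB g_neq[OF that] by (auto simp: pairwise_def row_R)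
  from det_orthogonal_matrix[OF R] show ?thesis
  proof
    assume "det R = 1"
    then show ?thesis using R orth that by (simp add: rotation_matrix_def)
  next
    assume det: "det R = -1"
    fix k :: 'd
    define R' where "R' = (\<chi> i. if i = k then - 1 *s row i R else row i R)"
    have row_R': "row i R' = (if i = k then - row i R else row i R)" for i
      by (simp add: row_def R'_def vec_eq_iff)
    have "det R' = - 1 * det (\<chi> i. if i = k then row i R else row i R)"
      unfolding R'_def by (rule det_row_mul)
    also have "(\<chi> i. if i = k then row i R else row i R) = R" by (simp add: row_def vec_eq_iff)
    finally have "det R' = 1" using det by simp
    moreover have "orthogonal_matrix R'"
      using R unfolding orthogonal_matrix_orthonormal_rows row_R'
      by (auto simp: orthogonal_clauses)
    ultimately have "rotation_matrix R'" by (simp add: rotation_matrix_def)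
    moreover have "orthogonal (T (row i R')) (T (row j R'))" if "i \<noteq> j" for i j
      using orth[OF that] by (auto simp: row_R' linear_neg[OF T] orthogonal_clauses)
    ultimately show ?thesis using that by blast
  qed
qed

section \<open>Quantum walks and momentum operators\<close>

definition delta_state :: "int^'d::finite \<Rightarrow> 'c \<Rightarrow> int^'d \<Rightarrow> complex^'c::finite" where
  "delta_state m k n = (if n = m then axis k 1 else 0)"

lemma delta_state_lattice: "delta_state m k \<in> lattice_states"
proof -
  have "(\<lambda>n. (norm (delta_state m k n))\<^sup>2) summable_on {m}" by simp
  then show ?thesis unfolding lattice_states_def mem_Collect_eq
    by (rule summable_on_cong_neutral[THEN iffD1, rotated -1]) (auto simp: delta_state_def)
qed

lemma walk_operator_delta_state:
  fixes A :: "int^'d::finite \<Rightarrow> complex^'c::finite^'c"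
  assumes "finite Q"
  shows "walk_operator Q A (delta_state m k) n = (if n - m \<in> Q then column k (A (n - m)) else 0)"
proof -
  have "walk_operator Q A (delta_state m k) n
    = (\<Sum>q\<in>Q. if q = n - m then column k (A (n - m)) else 0)"
    unfolding walk_operator_def
    by (intro sum.cong) (auto simp: shift_def delta_state_def matrix_vector_mult_axis algebra_simps)
  then show ?thesis using assms by (simp add: sum.delta)
qed

lemma lattice_inner_delta_state:
  "lattice_inner (delta_state m k) (delta_state n l) = (if m = n \<and> k = l then 1 else 0)"
proof -
  have "lattice_inner (delta_state m k) (delta_state n l)
     = (\<Sum>\<^sub>\<infinity>x\<in>{m}. \<Sum>j\<in>UNIV. cnj (delta_state m k x $ j) * delta_state n l x $ j)"
    unfolding lattice_inner_def by (rule infsum_cong_neutral) (auto simp: delta_state_def)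
  also have "\<dots> = (\<Sum>j\<in>UNIV. if j = k then delta_state n l m $ k else 0)"
    by (simp only: infsum_finite finite.intros sum.insert sum.empty empty_iff not_False_eq_True
        add.right_neutral) (rule sum.cong, auto simp: delta_state_def axis_def)
  also have "\<dots> = (if m = n \<and> k = l then 1 else 0)"
    by (simp add: delta_state_def axis_def)
  finally show ?thesis .
qed

text \<open>Inner products of images of basis states at sites 0 and \<open>m\<close> are compared:
  at site \<open>q\<close> these images are columns of \<open>A q\<close> and
  \<open>A (q - m)\<close>, and they overlap only where both indices lie in
  \<open>Q\<close>.\<close>

lemma quantum_walk_orthogonality:
  assumes "quantum_walk Q A"
  shows "(\<Sum>q\<in>{q\<in>Q. q - m \<in> Q}. \<Sum>j\<in>UNIV. cnj (A q $ j $ k) * A (q - m) $ j $ l)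
    = (if m = 0 \<and> k = l then 1 else 0)"
proof -
  have fin: "finite Q" using assms by (simp add: quantum_walk_def)
  have "lattice_inner (walk_operator Q A (delta_state 0 k)) (walk_operator Q A (delta_state m l))
    = (\<Sum>\<^sub>\<infinity>q\<in>{q\<in>Q. q - m \<in> Q}. \<Sum>j\<in>UNIV. cnj (A q $ j $ k) * A (q - m) $ j $ l)"
    unfolding lattice_inner_def
    by (rule infsum_cong_neutral) (auto simp: walk_operator_delta_state[OF fin] column_def)
  moreover have "lattice_inner (walk_operator Q A (delta_state 0 k)) (walk_operator Q A (delta_state m l))
    = lattice_inner (delta_state 0 k) (delta_state m l)"
    using assms delta_state_lattice unfolding quantum_walk_def by blast
  ultimately show ?thesis
    using fin by (simp add: lattice_inner_delta_state split del: if_split)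
qed

text \<open>The coefficient of the \<open>b\<close>-th momentum operator in the continuum
  Hamiltonian.\<close>

definition velocity_matrix :: "(int^'d::finite) set \<Rightarrow> (int^'d \<Rightarrow> complex^'c^'c) \<Rightarrow> 'd \<Rightarrow> complex^'c^'c" where
  "velocity_matrix Q A b = (\<Sum>q\<in>Q. real_of_int (q $ b) *\<^sub>R A q)"

text \<open>In momentum space U(k), the sum of the \<open>A q\<close> times exp(-i q.k), is unitary
  with U(0) = 1, so i times its derivative at 0 is Hermitian. The proof does this differentiation on
  coefficients.\<close>

lemma velocity_matrix_hermitian:
  fixes A :: "int^'d::finite \<Rightarrow> complex^'c::finite^'c"
  assumes walk: "quantum_walk Q A" and "massless Q A"
  shows "conj_transpose (velocity_matrix Q A b) = velocity_matrix Q A b"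
proof -
  have fin: "finite Q" using walk by (simp add: quantum_walk_def)
  have sumA: "(\<Sum>q\<in>Q. A q $ i $ j) = (if i = j then 1 else 0)" for i j
    using arg_cong[OF assms(2)[unfolded massless_def], of "\<lambda>M. M $ i $ j"]
    by (simp add: mat_def)
  have comp: "velocity_matrix Q A b $ i $ j = (\<Sum>q\<in>Q. of_int (q $ b) * A q $ i $ j)" for i j
    by (simp add: velocity_matrix_def) (simp add: scaleR_conv_of_real)
  have "cnj (velocity_matrix Q A b $ l $ k) = velocity_matrix Q A b $ k $ l" for k l
  proof -
    \<comment> \<open>The (k, l) entry of the adjoint of \<open>A q\<close> times
      \<open>A r\<close>.\<close>
    define F where "F q r = (\<Sum>j\<in>UNIV. cnj (A q $ j $ k) * A r $ j $ l)" for q r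
    \<comment> \<open>Pairs are grouped by their difference m: the weight kills m = 0, unitarity
      every other group.\<close>
    have "(\<Sum>(q, r)\<in>Q \<times> Q. of_int ((q - r) $ b) * F q r)
      = (\<Sum>m\<in>(\<lambda>(q, r). q - r) ` (Q \<times> Q).
           \<Sum>(q, r)\<in>{p \<in> Q \<times> Q. (\<lambda>(q, r). q - r) p = m}. of_int ((q - r) $ b) * F q r)"
      using fin by (intro sum.group[symmetric]) auto
    also have "\<dots> = 0"
    proof (rule sum.neutral, rule ballI)
      fix m
      have "(\<Sum>(q, r)\<in>{p \<in> Q \<times> Q. (\<lambda>(q, r). q - r) p = m}. of_int ((q - r) $ b) * F q r)
        = (\<Sum>q\<in>{q\<in>Q. q - m \<in> Q}. of_int (m $ b) * F q (q - m))"
        by (rule sum.reindex_bij_witness[of _ "\<lambda>q. (q, q - m)" fst]) auto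
      also have "\<dots> = of_int (m $ b) * (if m = 0 \<and> k = l then 1 else 0)"
        unfolding sum_distrib_left[symmetric] F_def quantum_walk_orthogonality[OF walk] ..
      also have "\<dots> = 0" by simp
      finally show "(\<Sum>(q, r)\<in>{p \<in> Q \<times> Q. (\<lambda>(q, r). q - r) p = m}. of_int ((q - r) $ b) * F q r) = 0" .
    qed
    finally have 0: "(\<Sum>q\<in>Q. \<Sum>r\<in>Q. of_int (q $ b) * F q r) = (\<Sum>q\<in>Q. \<Sum>r\<in>Q. of_int (r $ b) * F q r)"
      by (simp add: sum.cartesian_product[symmetric] left_diff_distrib sum_subtractf)
    \<comment> \<open>Masslessness collapses the unweighted sum over r to the identity, leaving the
      adjoint; with the weight on r, below, the matrix itself remains.\<close>
    have "(\<Sum>q\<in>Q. \<Sum>r\<in>Q. of_int (q $ b) * F q r)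
      = (\<Sum>j\<in>UNIV. (\<Sum>q\<in>Q. of_int (q $ b) * cnj (A q $ j $ k)) * (\<Sum>r\<in>Q. A r $ j $ l))"
    proof -
      have "(\<Sum>q\<in>Q. \<Sum>r\<in>Q. of_int (q $ b) * F q r)
        = (\<Sum>q\<in>Q. \<Sum>j\<in>UNIV. \<Sum>r\<in>Q. of_int (q $ b) * (cnj (A q $ j $ k) * A r $ j $ l))"
        unfolding F_def sum_distrib_left by (intro sum.cong refl sum.swap)
      also have "\<dots> = (\<Sum>j\<in>UNIV. \<Sum>q\<in>Q. \<Sum>r\<in>Q. of_int (q $ b) * (cnj (A q $ j $ k) * A r $ j $ l))"
        by (rule sum.swap)
      finally show ?thesis unfolding cnj_sum sum_product by (simp only: mult_ac)
    qed
    also have "\<dots> = cnj (velocity_matrix Q A b $ l $ k)"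
      by (simp add: sumA comp if_distrib cong: if_cong)
    finally have 1: "(\<Sum>q\<in>Q. \<Sum>r\<in>Q. of_int (q $ b) * F q r) = cnj (velocity_matrix Q A b $ l $ k)" .
    have "(\<Sum>q\<in>Q. \<Sum>r\<in>Q. of_int (r $ b) * F q r)
      = (\<Sum>j\<in>UNIV. cnj (\<Sum>q\<in>Q. A q $ j $ k) * (\<Sum>r\<in>Q. of_int (r $ b) * A r $ j $ l))"
    proof -
      have "(\<Sum>q\<in>Q. \<Sum>r\<in>Q. of_int (r $ b) * F q r)
        = (\<Sum>q\<in>Q. \<Sum>j\<in>UNIV. \<Sum>r\<in>Q. of_int (r $ b) * (cnj (A q $ j $ k) * A r $ j $ l))"
        unfolding F_def sum_distrib_left by (intro sum.cong refl sum.swap)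
      also have "\<dots> = (\<Sum>j\<in>UNIV. \<Sum>q\<in>Q. \<Sum>r\<in>Q. of_int (r $ b) * (cnj (A q $ j $ k) * A r $ j $ l))"
        by (rule sum.swap)
      finally show ?thesis unfolding cnj_sum sum_product by (simp only: mult_ac)
    qed
    also have "\<dots> = velocity_matrix Q A b $ k $ l"
      by (simp add: sumA comp if_distrib if_distribR cong: if_cong)
    finally show ?thesis using 0 1 by simp
  qed
  then show ?thesis by (simp add: vec_eq_iff conj_transpose_component)
qed

section \<open>The Hamiltonian in terms of momenta, and momenta under linear maps\<close>

lemma continuum_hamiltonian_velocity_matrix:
  "continuum_hamiltonian Q A \<phi> x = (\<Sum>b\<in>UNIV. velocity_matrix Q A b *v momentum b \<phi> x)"
  unfolding continuum_hamiltonian_def dot_momentum_def velocity_matrix_def of_real_vector_smult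
    sum_matrix_vector_mult matrix_vector_mult_sum scaleR_matrix_vector_mult
    matrix_vector_mult_scaleR_complex
  by (subst sum.swap) simp

lemma momentum_linear_compose:
  fixes \<phi> :: "('d::finite, 'c::finite) wave"
  assumes "linear L" and "\<phi> differentiable_on UNIV"
  shows "momentum b (\<lambda>x. \<phi> (L x)) x = (\<Sum>c\<in>UNIV. L (axis b 1) $ c *\<^sub>R momentum c \<phi> (L x))"
proof -
  have d: "(\<phi> has_derivative frechet_derivative \<phi> (at y)) (at y)" for y
    using assms(2) by (simp add: differentiable_on_def frechet_derivative_works[symmetric])
  have "((\<lambda>x. \<phi> (L x)) has_derivative (\<lambda>h. frechet_derivative \<phi> (at (L x)) (L h))) (at x)"
    using assms(1) by (intro has_derivative_compose[OF _ d] linear_imp_has_derivative)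
  then have fd: "frechet_derivative (\<lambda>x. \<phi> (L x)) (at x) = (\<lambda>h. frechet_derivative \<phi> (at (L x)) (L h))"
    by (rule frechet_derivative_at[symmetric])
  have expand: "frechet_derivative \<phi> (at y) v = (\<Sum>c\<in>UNIV. v $ c *\<^sub>R frechet_derivative \<phi> (at y) (axis c 1))"
    for y v
  proof -
    have "linear (frechet_derivative \<phi> (at y))" using d has_derivative_linear by blast
    then show ?thesis
      by (subst basis_expansion[symmetric, of v])
        (simp add: linear_sum linear_scale scalar_mult_eq_scaleR)
  qed
  show ?thesis
    unfolding momentum_def fd expand[of "L x" "L (axis b 1)"]
    by (simp add: vec_eq_iff sum_distrib_left sum_negf)
qed

lemma momentum_matrix_vector_mult:
  fixes \<phi> :: "('d::finite, 'c::finite) wave"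
  assumes "\<phi> differentiable_on UNIV"
  shows "momentum b (\<lambda>y. M *v \<phi> y) x = M *v momentum b \<phi> x"
proof -
  have d: "(\<phi> has_derivative frechet_derivative \<phi> (at x)) (at x)"
    using assms by (simp add: differentiable_on_def frechet_derivative_works[symmetric])
  have "bounded_linear (\<lambda>v. M *v v)"
    by (intro linear_linear[THEN iffD2] linearI)
      (auto simp: matrix_vector_right_distrib matrix_vector_mult_scaleR_complex)
  then have "((\<lambda>y. M *v \<phi> y) has_derivative (\<lambda>h. M *v frechet_derivative \<phi> (at x) h)) (at x)"
    using d by (rule bounded_linear.has_derivative)
  then have "frechet_derivative (\<lambda>y. M *v \<phi> y) (at x) = (\<lambda>h. M *v frechet_derivative \<phi> (at x) h)"
    by (rule frechet_derivative_at[symmetric])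
  then show ?thesis
    by (simp add: momentum_def vec_eq_iff matrix_vector_mult_def sum_distrib_left sum_negf mult_ac)
qed

section \<open>The continuum Hamiltonian\<close>

text \<open>At most three pairwise orthogonal vectors of \<open>real^3\<close> are nonzero; their
  number selects the zero, Dirac or Weyl form, and \<open>pauli_frame\<close> supplies the coin
  basis.\<close>

lemma massless_relativistic_pauli_comb:
  fixes H :: "('d::finite, 2) wave \<Rightarrow> ('d, 2) wave" and u :: "'d \<Rightarrow> real^3"
  assumes norm_u: "\<And>c. u c \<noteq> 0 \<Longrightarrow> norm (u c) = 1"
    and orth: "\<And>c c'. c \<noteq> c' \<Longrightarrow> orthogonal (u c) (u c')"
    and H: "\<And>\<phi> x. \<phi> differentiable_on UNIV \<Longrightarrow>
      H \<phi> x = (\<Sum>c\<in>UNIV. pauli_comb (u c) *v momentum c \<phi> x)"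
  shows "massless_relativistic H"
proof -
  define C where "C = {c. u c \<noteq> 0}"
  have H_C: "H \<phi> x = (\<Sum>c\<in>C. pauli_comb (u c) *v momentum c \<phi> x)"
    if "\<phi> differentiable_on UNIV" for \<phi> x
    unfolding H[OF that] C_def
    by (rule sum.mono_neutral_right) (auto simp: linear_0[OF linear_pauli_comb])
  have nC: "norm (u c) = 1" if "c \<in> C" for c using that norm_u by (simp add: C_def)
  have "inj_on u C"
    using orth by (auto simp: inj_on_def C_def) (metis orthogonal_self)
  moreover have "independent (u ` C)"
    using orth by (intro pairwise_orthogonal_independent) (auto simp: pairwise_def C_def, metis)
  ultimately have "card C \<le> 3"
    using independent_bound[of "u ` C"] by (simp add: card_image)
  then consider "card C = 0" | "card C = 1" | "card C = 2" | "card C = 3" by linarith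
  then show ?thesis
  proof cases
    case 1
    then have "C = {}" by simp
    then have "H \<phi> = change_coin_basis (mat 1) (\<lambda>\<phi> x. 0) \<phi>" if "\<phi> differentiable_on UNIV" for \<phi>
      using H_C[OF that] by (simp add: fun_eq_iff change_coin_basis_def)
    moreover have "unitary_matrix (mat 1 :: complex^2^2)"
      by (simp add: unitary_matrix_def vec_eq_iff conj_transpose_component mat_def
          matrix_matrix_mult_def forall_2 sum_2)
    ultimately show ?thesis
      unfolding massless_relativistic_def using massless_relativistic_form.dim0 by blast
  next
    case 2
    then obtain i where C: "C = {i}" by (auto simp: card_1_singleton_iff)
    \<comment> \<open>The one-dimensional form uses \<open>pauli_z\<close>, so \<open>u i\<close> is
      completed to a frame in which it is the third vector.\<close>
    obtain a0 :: "real^3" where a0: "a0 \<noteq> 0" "orthogonal (u i) a0"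
      using orthogonal_to_vector_exists[of "u i"] by auto
    define a where "a = inverse (norm a0) *\<^sub>R a0"
    have a: "norm a = 1" "orthogonal (u i) a"
      using a0 by (auto simp: a_def orthogonal_clauses)
    define b where "b = cross3 (u i) a"
    have "norm b = 1"
      using norm_cross_dot[of "u i" a] a nC[of i] C
      by (simp add: b_def orthogonal_def power2_eq_1_iff) (smt (verit) norm_ge_zero)
    moreover have "orthogonal a b" by (simp add: b_def orthogonal_def dot_cross_self)
    moreover have "cross3 a b = u i"
      using a by (simp add: b_def Lagrange norm_eq_1 orthogonal_def inner_commute)
    ultimately obtain W where W: "unitary_matrix W" "pauli_comb (u i) ** W = W ** pauli_z"
      using pauli_frame[of a b] a by metis
    have "H \<phi> = change_coin_basis W (dirac1_hamiltonian i) \<phi>" if "\<phi> differentiable_on UNIV" for \<phi>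
      using that
      by (simp add: fun_eq_iff change_coin_basis_def dirac1_hamiltonian_def H_C C
          momentum_matrix_vector_mult unitary_conjugate_mult[OF W])
    then show ?thesis
      unfolding massless_relativistic_def using massless_relativistic_form.dim1 W(1) by blast
  next
    case 3
    then obtain i j where C: "C = {i, j}" "i \<noteq> j" by (auto simp: card_2_iff)
    obtain W where W: "unitary_matrix W" "pauli_comb (u i) ** W = W ** pauli_x"
        "pauli_comb (u j) ** W = W ** pauli_y"
      using pauli_frame[of "u i" "u j"] orth[OF C(2)] nC C by blast
    have "H \<phi> = change_coin_basis W (dirac2_hamiltonian i j) \<phi>" if "\<phi> differentiable_on UNIV" for \<phi>
      using that C(2)
      by (simp add: fun_eq_iff change_coin_basis_def dirac2_hamiltonian_def H_C C(1)
          momentum_matrix_vector_mult matrix_vector_right_distrib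
          unitary_conjugate_mult[OF W(1,2)] unitary_conjugate_mult[OF W(1,3)])
    moreover have "distinct [i, j]" using C by simp
    ultimately show ?thesis
      unfolding massless_relativistic_def using massless_relativistic_form.dim2 W(1) by blast
  next
    case 4
    then obtain i j k where ijk: "C = {i, j, k}" "i \<noteq> j" "i \<noteq> k" "j \<noteq> k"
      by (auto simp: card_3_iff)
    have n: "norm (u i) = 1" "norm (u j) = 1" "norm (u k) = 1" using nC ijk by auto
    \<comment> \<open>Exchanging the first two axes reverses the orientation, so the negative Weyl
      Hamiltonian is never needed.\<close>
    obtain i' j' where C: "C = {i', j', k}" and d: "distinct [i', j', k]"
      and uk: "cross3 (u i') (u j') = u k"
    proof -
      have "u k = cross3 (u i) (u j) \<or> u k = cross3 (u j) (u i)"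
        using ijk by (intro orthonormal_cross3 n orth)
      then show thesis
        using that[of i j] that[of j i] ijk by (auto simp: insert_commute)
    qed
    obtain W where W: "unitary_matrix W" "pauli_comb (u i') ** W = W ** pauli_x"
        "pauli_comb (u j') ** W = W ** pauli_y" "pauli_comb (u k) ** W = W ** pauli_z"
      using pauli_frame[of "u i'" "u j'"] orth[of i' j'] nC C d uk by auto
    have "H \<phi> = change_coin_basis W (weyl_hamiltonian i' j' k) \<phi>" if "\<phi> differentiable_on UNIV" for \<phi>
      using that d
      by (simp add: fun_eq_iff change_coin_basis_def weyl_hamiltonian_def H_C C
          momentum_matrix_vector_mult matrix_vector_right_distrib add.assoc
          unitary_conjugate_mult[OF W(1,2)] unitary_conjugate_mult[OF W(1,3)]
          unitary_conjugate_mult[OF W(1,4)])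
    then show ?thesis
      unfolding massless_relativistic_def using massless_relativistic_form.dim3_pos[OF d] W(1) by blast
  qed
qed

section \<open>The change of coordinates\<close>

lemma linear_rotate_rescale: "linear (rotate_rescale R s)"
  by (rule linearI)
    (simp_all add: rotate_rescale_def vec_eq_iff matrix_vector_right_distrib
      matrix_vector_mult_scaleR algebra_simps)

lemma rotate_rescale_axis: "rotate_rescale R s (axis b 1) $ c = s $ c * R $ c $ b"
  by (simp add: rotate_rescale_def matrix_vector_mult_basis column_def)

lemma surj_rotate_rescale:
  assumes "rotation_matrix R" and "\<And>b. s $ b \<noteq> 0"
  shows "surj (rotate_rescale R s)"
proof (rule surjI)
  fix y
  have "R ** transpose R = mat 1"
    using assms(1) by (simp add: rotation_matrix_def orthogonal_matrix_def)
  then have "R *v (transpose R *v x) = x" for x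
    by (simp only: matrix_vector_mul_assoc matrix_vector_mul_lid)
  \<comment> \<open>The preimage undoes the rescaling and then rotates back.\<close>
  then show "rotate_rescale R s (transpose R *v (\<chi> b. y $ b / s $ b)) = y"
    using assms(2) by (simp only: rotate_rescale_def) (simp add: vec_eq_iff)
qed

theorem theorem3p6:
  fixes Q :: "(int^'d::finite) set"
    and A :: "int^'d \<Rightarrow> complex^2^2"
  assumes "quantum_walk Q A"
    and "massless Q A"
  shows "\<exists>(v :: real^'d) (R :: real^'d^'d) (s :: real^'d).
    rotation_matrix R \<and> (\<forall>b. s $ b > 0) \<and>
    massless_relativistic
      (in_coordinates (rotate_rescale R s)
        (remove_velocity v (continuum_hamiltonian Q A)))"
proof -
  have "\<exists>r n. velocity_matrix Q A b = r *\<^sub>R mat 1 + pauli_comb n" for b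
    using hermitian_eq_pauli_comb[OF velocity_matrix_hermitian[OF assms]] by blast
  then obtain r n where rn: "\<And>b. velocity_matrix Q A b = r b *\<^sub>R mat 1 + pauli_comb (n b)"
    by metis
  \<comment> \<open>The identity parts of the velocity matrices form the velocity to be
    removed.\<close>
  define v :: "real^'d" where "v = (\<chi> b. r b)"
  \<comment> \<open>\<open>T\<close> sends the \<open>b\<close>-th axis to the Pauli vector
    \<open>n b\<close>.\<close>
  define T :: "real^'d \<Rightarrow> real^3" where "T w = (\<Sum>b\<in>UNIV. w $ b *\<^sub>R n b)" for w
  have "linear T"
    by (rule linearI) (simp_all add: T_def scaleR_add_left sum.distrib scaleR_sum_right)
  then obtain R :: "real^'d^'d" where R: "rotation_matrix R"
    and orth: "\<And>i j. i \<noteq> j \<Longrightarrow> orthogonal (T (row i R)) (T (row j R))"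
    using rotation_orthogonal_images by blast
  \<comment> \<open>Nonzero images are normalised; for zero images any positive factor would do, and
    1 is chosen.\<close>
  define s :: "real^'d" where
    "s = (\<chi> c. if T (row c R) = 0 then 1 else inverse (norm (T (row c R))))"
  have s: "s $ b > 0" for b by (simp add: s_def)
  let ?L = "rotate_rescale R s"
  have "massless_relativistic (in_coordinates ?L (remove_velocity v (continuum_hamiltonian Q A)))"
  proof (rule massless_relativistic_pauli_comb)
    fix c assume "s $ c *\<^sub>R T (row c R) \<noteq> 0"
    then show "norm (s $ c *\<^sub>R T (row c R)) = 1" by (simp add: s_def)
  next
    fix c c' :: 'd assume "c \<noteq> c'"
    then show "orthogonal (s $ c *\<^sub>R T (row c R)) (s $ c' *\<^sub>R T (row c' R))"
      using orth by (simp add: orthogonal_clauses)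
  next
    fix \<phi> :: "('d, 2) wave" and y
    assume \<phi>: "\<phi> differentiable_on UNIV"
    have "surj ?L" using R s by (intro surj_rotate_rescale) (auto simp: less_le)
    then have inv: "?L (inv ?L y) = y" by (rule surj_f_inv_f)
    have H: "remove_velocity v (continuum_hamiltonian Q A) \<psi> x
      = (\<Sum>b\<in>UNIV. pauli_comb (n b) *v momentum b \<psi> x)" for \<psi> x
      by (simp add: remove_velocity_def continuum_hamiltonian_velocity_matrix rn v_def
          matrix_vector_mult_add_rdistrib dot_momentum_def of_real_vector_smult
          scaleR_matrix_vector_mult sum.distrib)
    have "in_coordinates ?L (remove_velocity v (continuum_hamiltonian Q A)) \<phi> y
      = (\<Sum>b\<in>UNIV. \<Sum>c\<in>UNIV. (s $ c * R $ c $ b) *\<^sub>R (pauli_comb (n b) *v momentum c \<phi> y))"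
      by (simp add: in_coordinates_def H momentum_linear_compose[OF linear_rotate_rescale \<phi>] inv
          rotate_rescale_axis matrix_vector_mult_sum matrix_vector_mult_scaleR_complex)
    also have "\<dots> = (\<Sum>c\<in>UNIV. \<Sum>b\<in>UNIV. (s $ c * R $ c $ b) *\<^sub>R (pauli_comb (n b) *v momentum c \<phi> y))"
      by (rule sum.swap)
    \<comment> \<open>The coefficient of the \<open>c\<close>-th new momentum is collected: row
      \<open>c\<close> of \<open>R\<close> combines the vectors \<open>n b\<close> into
      \<open>T (row c R)\<close>.\<close>
    also have "\<dots> = (\<Sum>c\<in>UNIV. pauli_comb (s $ c *\<^sub>R T (row c R)) *v momentum c \<phi> y)"
      by (simp add: T_def row_def linear_scale[OF linear_pauli_comb] linear_sum[OF linear_pauli_comb]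
          scaleR_matrix_vector_mult sum_matrix_vector_mult scaleR_sum_right)
    finally show "in_coordinates ?L (remove_velocity v (continuum_hamiltonian Q A)) \<phi> y
      = (\<Sum>c\<in>UNIV. pauli_comb (s $ c *\<^sub>R T (row c R)) *v momentum c \<phi> y)" .
  qed
  then show ?thesis using R s by blast
qed

end
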